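(* Let $(M,\nabla,\circ,e,\nabla^*,*,E)$ be a bi-flat F-manifold, $L=E\circ$, $L_\lambda=L-\lambda I$, and let $$\nabla^{GM}_XY=\nabla^*_XY+\lambda\left(\nabla^*_{L_{\lambda}^{-1}X}Y-\nabla_{L_{\lambda}^{-1}X}Y\right)$$ be the associated family of Gauss-Manin connections. Let $X$ be a local section of $\mathcal{T}_M$ (depending on $\lambda$) that is flat with respect to $\nabla^{GM}$, i.e. $\nabla^{GM}X=0$, and view $X$ as an element of $\mathcal{T}_M[[\lambda^{-1}]]$, $$X=X_{(0)}+\frac{X_{(1)}}{\lambda}+\frac{X_{(2)}}{\lambda^2}+\cdots .$$ Then the coefficients of this formal power series satisfy the Lenard-Magri recurrence relations $$d_\nabla X_{(\alpha+1)}=d_{L\nabla^*}X_{(\alpha)},\qquad \alpha\in\mathbb{N}=\{0,1,2,\dots\},$$ equivalently $\nabla_YX_{(\alpha+1)}=\nabla^*_{E\circ Y}X_{(\alpha)}$ for all local sections $Y$ of $\mathcal{T}_M$.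
   Context: Conventions: $M$ is a smooth, real analytic or complex manifold, $\mathcal{T}_M$ its tangent sheaf, $\mathcal{O}_M$ its structure sheaf; in the complex case everything is holomorphic. $X,Y,Z,W$ denote arbitrary local sections of $\mathcal{T}_M$. Everything involving $\nabla^*$ is considered on the locus $U$ where $E\circ$ is invertible. For formal power series in $\lambda^{-1}$, the connections act coefficientwise and $L_\lambda^{-1}$ is expanded in powers of $\lambda^{-1}$; $\nabla^{GM}X=0$ amounts to $\nabla^{GM}_{L_\lambda Y}X=0$ for all $Y$. F-manifold $(M,\circ,e)$: $\circ$ is an $\mathcal{O}_M$-bilinear commutative associative product on $\mathcal{T}_M$ with unit a global vector field $e$ ($e\circ X=X$), satisfying $[X\circ Y,W\circ Z]-[X\circ Y,Z]\circ W-[X\circ Y,W]\circ Z-X\circ[Y,Z\circ W]+X\circ[Y,Z]\circ W+X\circ[Y,W]\circ Z-Y\circ[X,Z\circ W]+Y\circ[X,Z]\circ W+Y\circ[X,W]\circ Z=0$. Flat F-manifold $(M,\nabla,\circ,e)$: an F-manifold with a connection $\nabla$ on $\mathcal{T}_M$ such that for every constant $\lambda$ the connection $(X,Y)\mapsto \nabla_XY-\lambda X\circ Y$ is flat and torsionless, and $\nabla e=0$. Euler vector field of an F-manifold: a global vector field $E$ with $[e,E]=e$ and $\mathcal{L}_E\circ=\circ$, i.e. $[E,X\circ Y]-[E,X]\circ Y-X\circ[E,Y]=X\circ Y$. Bi-flat F-manifold $(M,\nabla,\circ,e,\nabla^*,*,E)$: (i) $(\nabla,\circ,e)$ is a flat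 F-structure on $M$; (ii) $E$ is an Euler vector field for $(M,\circ,e)$ and the operator $E\circ$ is invertible at generic points, i.e. on an open dense subset $U$; (iii) on $U$, $X*Y=(E\circ)^{-1}(X\circ Y)$; (iv) $(\nabla^*,*,E)$ is a flat F-structure on $U$ (with unit $E$, so $\nabla^*E=0$); (v) $(d_\nabla-d_{\nabla^*})(X\circ)=0$ for all local $X$, i.e. $\nabla_Y(X\circ Z)-\nabla_Z(X\circ Y)=\nabla^*_Y(X\circ Z)-\nabla^*_Z(X\circ Y)$. Differentials on vector fields: for a local section $Z$ of $\mathcal{T}_M$, $d_\nabla Z$ and $d_{L\nabla^*}Z$ are the $\mathcal{T}_M$-valued 1-forms $(d_\nabla Z)(Y)=\nabla_YZ$ and $(d_{L\nabla^*}Z)(Y)=\nabla^*_{LY}Z$. *)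

theory Defs
  imports "HOL-Analysis.Analysis" "HOL-Library.Function_Algebras"
begin

text \<open>
  Sheaves on a manifold are modelled by their local sections. A function on an open set \<open>W\<close> is
  represented by its extension by zero to the whole type, and a section over \<open>W\<close> of the tangent
  sheaf is a derivation of the sheaf of algebras \<open>\<O>\<^sub>W\<close>, i.e. a family of derivations
  \<open>D V : \<O>(V) \<rightarrow> \<O>(V)\<close>, for all open \<open>V\<close> contained in \<open>W\<close>, that commutes with restriction; it is
  extended by zero to all other arguments. Hence sums, differences and zero of local sections
  are the pointwise ones of \<^theory>\<open>HOL-Library.Function_Algebras\<close>, and equality of local
  sections over \<open>W\<close> is equality of functions.
\<close>

section \<open>Smooth, real analytic and complex manifolds\<close>

text \<open>
  The ground field is a type of class \<^class>\<open>real_normed_field\<close>; since its norm is multiplicative,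
  such a field is isomorphic to \<open>\<real>\<close> or \<open>\<complex>\<close> (Gelfand--Mazur). Over \<open>\<real>\<close> the two regularity classes
  give smooth and real analytic manifolds, over \<open>\<complex>\<close> both give complex manifolds: the derivative
  in \<open>differentiable_times\<close> is required to be linear over the ground field.
\<close>

datatype regularity = Smooth | Analytic

primrec differentiable_times ::
  "nat \<Rightarrow> ('k::real_normed_field ^ 'n::finite) set \<Rightarrow> ('k ^ 'n \<Rightarrow> 'k) \<Rightarrow> bool"
where
  "differentiable_times 0 S f \<longleftrightarrow> continuous_on S f"
| "differentiable_times (Suc m) S f \<longleftrightarrow>
     (\<exists>f'. (\<forall>x\<in>S. (f has_derivative (\<lambda>h. \<Sum>i\<in>UNIV. f' i x * h $ i)) (at x)) \<and>
           (\<forall>i. differentiable_times m S (f' i)))"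

definition power_series_on :: "('k::real_normed_field ^ 'n::finite) set \<Rightarrow> ('k ^ 'n \<Rightarrow> 'k) \<Rightarrow> bool"
  where "power_series_on S f \<longleftrightarrow>
    (\<forall>x\<in>S. \<exists>c r. r > 0 \<and>
      (\<forall>y. (\<forall>i. norm (y $ i - x $ i) < r) \<longrightarrow>
        y \<in> S \<and>
        ((\<lambda>m :: 'n \<Rightarrow> nat. c m * (\<Prod>i\<in>UNIV. (y $ i - x $ i) ^ m i)) has_sum f y) UNIV))"

text \<open>Regularity on an open set of the model space.\<close>

fun regular_on ::
  "regularity \<Rightarrow> ('k::real_normed_field ^ 'n::finite) set \<Rightarrow> ('k ^ 'n \<Rightarrow> 'k) \<Rightarrow> bool"
where
  "regular_on Smooth S f \<longleftrightarrow> (\<forall>m. differentiable_times m S f)"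
| "regular_on Analytic S f \<longleftrightarrow> power_series_on S f"

locale manifold =
  fixes r :: regularity
    and M :: "'a topology"
    and A :: "('a set \<times> ('a \<Rightarrow> 'k::real_normed_field ^ 'n::finite)) set"
  assumes Hausdorff: "Hausdorff_space M"
    and second_countable: "second_countable M"
    and charts_cover: "(\<Union>(D, \<phi>)\<in>A. D) = topspace M"
    and charts: "\<And>D \<phi>. (D, \<phi>) \<in> A \<Longrightarrow>
      openin M D \<and> open (\<phi> ` D) \<and>
      homeomorphic_map (subtopology M D) (top_of_set (\<phi> ` D)) \<phi>"
    and transition: "\<And>D \<phi> D' \<phi>' i. (D, \<phi>) \<in> A \<Longrightarrow> (D', \<phi>') \<in> A \<Longrightarrow>
      regular_on r (\<phi> ` (D \<inter> D')) (\<lambda>x. \<phi>' (inv_into D \<phi> x) $ i)"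

section \<open>Structure sheaf and tangent sheaf\<close>

type_synonym ('a, 'k) vector_field = "'a set \<Rightarrow> ('a \<Rightarrow> 'k) \<Rightarrow> 'a \<Rightarrow> 'k"

text \<open>
  Products and connections are families, indexed by open sets \<open>W\<close>, of binary operations on the
  vector fields over \<open>W\<close>; their values at arguments that are not sections over \<open>W\<close> are irrelevant.
\<close>

type_synonym ('a, 'k) sheaf_operation =
  "'a set \<Rightarrow> ('a, 'k) vector_field \<Rightarrow> ('a, 'k) vector_field \<Rightarrow> ('a, 'k) vector_field"

definition restrict_function :: "'a set \<Rightarrow> ('a \<Rightarrow> 'k::zero) \<Rightarrow> 'a \<Rightarrow> 'k"
  where "restrict_function W f = (\<lambda>p. if p \<in> W then f p else 0)"

definition restrict_field :: "'a set \<Rightarrow> ('a, 'k::zero) vector_field \<Rightarrow> ('a, 'k) vector_field"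
  where "restrict_field W X = (\<lambda>V f. if V \<subseteq> W then X V f else 0)"

definition function_scale ::
  "('a \<Rightarrow> 'k::times) \<Rightarrow> ('a, 'k) vector_field \<Rightarrow> ('a, 'k) vector_field"
  where "function_scale g X = (\<lambda>V f p. g p * X V f p)"

definition constant_scale :: "'k::times \<Rightarrow> ('a, 'k) vector_field \<Rightarrow> ('a, 'k) vector_field"
  where "constant_scale c X = (\<lambda>V f p. c * X V f p)"

definition bracket ::
  "('a, 'k::minus) vector_field \<Rightarrow> ('a, 'k) vector_field \<Rightarrow> ('a, 'k) vector_field"
  where "bracket X Y = (\<lambda>V f. X V (Y V f) - Y V (X V f))"

context manifold
begin

definition structure_sheaf :: "'a set \<Rightarrow> ('a \<Rightarrow> 'k) set"
  where "structure_sheaf W = {f. (\<forall>p. p \<notin> W \<longrightarrow> f p = 0) \<and>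
    (\<forall>(D, \<phi>)\<in>A. regular_on r (\<phi> ` (D \<inter> W)) (\<lambda>x. f (inv_into D \<phi> x)))}"

definition tangent_sheaf :: "'a set \<Rightarrow> ('a, 'k) vector_field set"
  where "tangent_sheaf W = {D.
    (\<forall>V f. \<not> (openin M V \<and> V \<subseteq> W \<and> f \<in> structure_sheaf V) \<longrightarrow> D V f = 0) \<and>
    (\<forall>V. openin M V \<longrightarrow> V \<subseteq> W \<longrightarrow>
      (\<forall>f\<in>structure_sheaf V.
        D V f \<in> structure_sheaf V \<and>
        (\<forall>c. D V (\<lambda>p. c * f p) = (\<lambda>p. c * D V f p)) \<and>
        (\<forall>g\<in>structure_sheaf V.
          D V (\<lambda>p. f p + g p) = (\<lambda>p. D V f p + D V g p) \<and>
          D V (\<lambda>p. f p * g p) = (\<lambda>p. f p * D V g p + D V f p * g p)) \<and>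
        (\<forall>V'. openin M V' \<longrightarrow> V' \<subseteq> V \<longrightarrow>
          D V' (restrict_function V' f) = restrict_function V' (D V f))))}"

section \<open>Flat F-manifolds\<close>

definition sheaf_morphism :: "'a set \<Rightarrow> ('a, 'k) sheaf_operation \<Rightarrow> bool"
  where "sheaf_morphism U b \<longleftrightarrow>
    (\<forall>W. openin M W \<longrightarrow> W \<subseteq> U \<longrightarrow>
      (\<forall>X\<in>tangent_sheaf W. \<forall>Y\<in>tangent_sheaf W.
        b W X Y \<in> tangent_sheaf W \<and>
        (\<forall>W'. openin M W' \<longrightarrow> W' \<subseteq> W \<longrightarrow>
          restrict_field W' (b W X Y) = b W' (restrict_field W' X) (restrict_field W' Y))))"

definition bilinear_operation :: "'a set \<Rightarrow> ('a, 'k) sheaf_operation \<Rightarrow> bool"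
  where "bilinear_operation U b \<longleftrightarrow> sheaf_morphism U b \<and>
    (\<forall>W. openin M W \<longrightarrow> W \<subseteq> U \<longrightarrow>
      (\<forall>X\<in>tangent_sheaf W. \<forall>Y\<in>tangent_sheaf W.
        (\<forall>Z\<in>tangent_sheaf W.
          b W (X + Z) Y = b W X Y + b W Z Y \<and> b W X (Y + Z) = b W X Y + b W X Z) \<and>
        (\<forall>g\<in>structure_sheaf W.
          b W (function_scale g X) Y = function_scale g (b W X Y) \<and>
          b W X (function_scale g Y) = function_scale g (b W X Y))))"

definition connection :: "'a set \<Rightarrow> ('a, 'k) sheaf_operation \<Rightarrow> bool"
  where "connection U nabla \<longleftrightarrow> sheaf_morphism U nabla \<and>
    (\<forall>W. openin M W \<longrightarrow> W \<subseteq> U \<longrightarrow>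
      (\<forall>X\<in>tangent_sheaf W. \<forall>Y\<in>tangent_sheaf W.
        (\<forall>Z\<in>tangent_sheaf W.
          nabla W (X + Z) Y = nabla W X Y + nabla W Z Y \<and>
          nabla W X (Y + Z) = nabla W X Y + nabla W X Z) \<and>
        (\<forall>g\<in>structure_sheaf W.
          nabla W (function_scale g X) Y = function_scale g (nabla W X Y) \<and>
          nabla W X (function_scale g Y) =
            function_scale g (nabla W X Y) + function_scale (X W g) Y)))"

definition flat :: "'a set \<Rightarrow> ('a, 'k) sheaf_operation \<Rightarrow> bool"
  where "flat U nabla \<longleftrightarrow>
    (\<forall>W. openin M W \<longrightarrow> W \<subseteq> U \<longrightarrow>
      (\<forall>X\<in>tangent_sheaf W. \<forall>Y\<in>tangent_sheaf W. \<forall>Z\<in>tangent_sheaf W.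
        nabla W X (nabla W Y Z) - nabla W Y (nabla W X Z) - nabla W (bracket X Y) Z = 0))"

definition torsionless :: "'a set \<Rightarrow> ('a, 'k) sheaf_operation \<Rightarrow> bool"
  where "torsionless U nabla \<longleftrightarrow>
    (\<forall>W. openin M W \<longrightarrow> W \<subseteq> U \<longrightarrow>
      (\<forall>X\<in>tangent_sheaf W. \<forall>Y\<in>tangent_sheaf W.
        nabla W X Y - nabla W Y X = bracket X Y))"

definition F_manifold ::
  "'a set \<Rightarrow> ('a, 'k) sheaf_operation \<Rightarrow> ('a, 'k) vector_field \<Rightarrow> bool"
  where "F_manifold U prd e \<longleftrightarrow> bilinear_operation U prd \<and> e \<in> tangent_sheaf U \<and>
    (\<forall>W. openin M W \<longrightarrow> W \<subseteq> U \<longrightarrow>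
      (\<forall>X\<in>tangent_sheaf W. \<forall>Y\<in>tangent_sheaf W.
        prd W X Y = prd W Y X \<and>
        prd W (restrict_field W e) X = X \<and>
        (\<forall>Z\<in>tangent_sheaf W.
          prd W (prd W X Y) Z = prd W X (prd W Y Z) \<and>
          (\<forall>V\<in>tangent_sheaf W.
            bracket (prd W X Y) (prd W V Z)
            - prd W (bracket (prd W X Y) Z) V - prd W (bracket (prd W X Y) V) Z
            - prd W X (bracket Y (prd W Z V))
            + prd W (prd W X (bracket Y Z)) V + prd W (prd W X (bracket Y V)) Z
            - prd W Y (bracket X (prd W Z V))
            + prd W (prd W Y (bracket X Z)) V + prd W (prd W Y (bracket X V)) Z = 0))))"

definition flat_F_manifold ::
  "'a set \<Rightarrow> ('a, 'k) sheaf_operation \<Rightarrow> ('a, 'k) sheaf_operation \<Rightarrow> ('a, 'k) vector_field \<Rightarrow> bool"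
  where "flat_F_manifold U nabla prd e \<longleftrightarrow>
    F_manifold U prd e \<and> connection U nabla \<and>
    (\<forall>c. flat U (\<lambda>W X Y. nabla W X Y - constant_scale c (prd W X Y)) \<and>
         torsionless U (\<lambda>W X Y. nabla W X Y - constant_scale c (prd W X Y))) \<and>
    (\<forall>W. openin M W \<longrightarrow> W \<subseteq> U \<longrightarrow>
      (\<forall>X\<in>tangent_sheaf W. nabla W X (restrict_field W e) = 0))"

section \<open>Bi-flat F-manifolds\<close>

definition Euler_field ::
  "('a, 'k) sheaf_operation \<Rightarrow> ('a, 'k) vector_field \<Rightarrow> ('a, 'k) vector_field \<Rightarrow> bool"
  where "Euler_field prd e E \<longleftrightarrow> E \<in> tangent_sheaf (topspace M) \<and> bracket e E = e \<and>
    (\<forall>W. openin M W \<longrightarrow>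
      (\<forall>X\<in>tangent_sheaf W. \<forall>Y\<in>tangent_sheaf W.
        bracket (restrict_field W E) (prd W X Y)
        - prd W (bracket (restrict_field W E) X) Y
        - prd W X (bracket (restrict_field W E) Y) = prd W X Y))"

text \<open>The operator \<open>L = E\<circ>\<close> on vector fields over \<open>W\<close>.\<close>

definition mult_by ::
  "('a, 'k) sheaf_operation \<Rightarrow> ('a, 'k) vector_field \<Rightarrow> 'a set \<Rightarrow>
    ('a, 'k) vector_field \<Rightarrow> ('a, 'k) vector_field"
  where "mult_by prd E W Y = prd W (restrict_field W E) Y"

text \<open>The largest open set over which \<open>E\<circ>\<close> is an automorphism of the tangent sheaf.\<close>

definition invertible_locus ::
  "('a, 'k) sheaf_operation \<Rightarrow> ('a, 'k) vector_field \<Rightarrow> 'a set"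
  where "invertible_locus prd E = \<Union>{V. openin M V \<and>
    (\<forall>W. openin M W \<longrightarrow> W \<subseteq> V \<longrightarrow>
      bij_betw (mult_by prd E W) (tangent_sheaf W) (tangent_sheaf W))}"

definition bi_flat_F_manifold ::
  "('a, 'k) sheaf_operation \<Rightarrow> ('a, 'k) sheaf_operation \<Rightarrow> ('a, 'k) vector_field \<Rightarrow>
    ('a, 'k) sheaf_operation \<Rightarrow> ('a, 'k) sheaf_operation \<Rightarrow> ('a, 'k) vector_field \<Rightarrow> bool"
  where "bi_flat_F_manifold nabla prd e nabla_star prd_star E \<longleftrightarrow>
    (let U = invertible_locus prd E in
      flat_F_manifold (topspace M) nabla prd e \<and>
      Euler_field prd e E \<and>
      M closure_of U = topspace M \<and>
      (\<forall>W. openin M W \<longrightarrow> W \<subseteq> U \<longrightarrow>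
        (\<forall>X\<in>tangent_sheaf W. \<forall>Y\<in>tangent_sheaf W.
          prd_star W X Y = the_inv_into (tangent_sheaf W) (mult_by prd E W) (prd W X Y))) \<and>
      flat_F_manifold U nabla_star prd_star (restrict_field U E) \<and>
      (\<forall>W. openin M W \<longrightarrow> W \<subseteq> U \<longrightarrow>
        (\<forall>X\<in>tangent_sheaf W. \<forall>Y\<in>tangent_sheaf W. \<forall>Z\<in>tangent_sheaf W.
          nabla W Y (prd W X Z) - nabla W Z (prd W X Y) =
          nabla_star W Y (prd W X Z) - nabla_star W Z (prd W X Y))))"

section \<open>Differentials of vector fields\<close>

text \<open>
  A one-form on \<open>V\<close> with values in the tangent sheaf maps an open subset \<open>W\<close> of \<open>V\<close> and a vector
  field over \<open>W\<close> to a vector field over \<open>W\<close>; it is extended by zero to other arguments.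
\<close>

definition d_nabla ::
  "('a, 'k) sheaf_operation \<Rightarrow> 'a set \<Rightarrow> ('a, 'k) vector_field \<Rightarrow>
    'a set \<Rightarrow> ('a, 'k) vector_field \<Rightarrow> ('a, 'k) vector_field"
  where "d_nabla nabla V Z = (\<lambda>W Y.
    if openin M W \<and> W \<subseteq> V \<and> Y \<in> tangent_sheaf W
    then nabla W Y (restrict_field W Z) else 0)"

definition d_L_nabla ::
  "('a, 'k) sheaf_operation \<Rightarrow> ('a, 'k) sheaf_operation \<Rightarrow> ('a, 'k) vector_field \<Rightarrow> 'a set \<Rightarrow>
    ('a, 'k) vector_field \<Rightarrow> 'a set \<Rightarrow> ('a, 'k) vector_field \<Rightarrow> ('a, 'k) vector_field"
  where "d_L_nabla nabla prd E V Z = (\<lambda>W Y.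
    if openin M W \<and> W \<subseteq> V \<and> Y \<in> tangent_sheaf W
    then nabla W (mult_by prd E W Y) (restrict_field W Z) else 0)"

end

section \<open>The Gauss--Manin connections\<close>

text \<open>
  A formal power series in \<open>1/\<lambda>\<close> is the sequence of its coefficients: \<open>X k\<close> is the coefficient
  of \<open>\<lambda>\<^sup>-\<^sup>k\<close>.
\<close>

type_synonym ('a, 'k) series = "nat \<Rightarrow> ('a, 'k) vector_field"

text \<open>Multiplication by \<open>\<lambda>\<close> of a series without constant term.\<close>

definition lambda_times :: "('a, 'k) series \<Rightarrow> ('a, 'k) series"
  where "lambda_times Z = (\<lambda>k. Z (Suc k))"

text \<open>
  \<open>(L - \<lambda> I)\<^sup>-\<^sup>1 Y = - \<lambda>\<^sup>-\<^sup>1 (I - \<lambda>\<^sup>-\<^sup>1 L)\<^sup>-\<^sup>1 Y = - (\<Sum>k. \<lambda>\<^sup>-\<^sup>k\<^sup>-\<^sup>1 L\<^sup>k Y)\<close>.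
\<close>

definition resolvent ::
  "(('a, 'k::ab_group_add) vector_field \<Rightarrow> ('a, 'k) vector_field) \<Rightarrow>
    ('a, 'k) vector_field \<Rightarrow> ('a, 'k) series"
  where "resolvent L Y = (\<lambda>j. case j of 0 \<Rightarrow> 0 | Suc k \<Rightarrow> - (L ^^ k) Y)"

lemma resolvent_constant_term: "resolvent L Y 0 = 0"
  by (simp add: resolvent_def)

lemma resolvent_inverse:
  assumes "L 0 = 0" "\<And>Z. L (- Z) = - L Z"
  shows "(\<lambda>k. L (resolvent L Y k)) - lambda_times (resolvent L Y) = (\<lambda>k. if k = 0 then Y else 0)"
  by (auto simp: fun_eq_iff resolvent_def lambda_times_def assms split: nat.split)

text \<open>
  Extension of \<open>\<nabla>\<close> over \<open>W\<close> to formal series in both arguments, bilinearly over formal series in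
  \<open>1/\<lambda>\<close> with constant coefficients.
\<close>

definition series_connection ::
  "('a, 'k::ab_group_add) sheaf_operation \<Rightarrow> 'a set \<Rightarrow> ('a, 'k) series \<Rightarrow> ('a, 'k) series \<Rightarrow>
    ('a, 'k) series"
  where "series_connection nabla W Z X = (\<lambda>j. \<Sum>i\<le>j. nabla W (Z i) (X (j - i)))"

context manifold
begin

definition Gauss_Manin ::
  "('a, 'k) sheaf_operation \<Rightarrow> ('a, 'k) sheaf_operation \<Rightarrow> ('a, 'k) sheaf_operation \<Rightarrow>
    ('a, 'k) vector_field \<Rightarrow> 'a set \<Rightarrow> ('a, 'k) vector_field \<Rightarrow> ('a, 'k) series \<Rightarrow> ('a, 'k) series"
  where "Gauss_Manin nabla prd nabla_star E W Y X =
    (\<lambda>j. nabla_star W Y (X j)) +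
    lambda_times
      (series_connection nabla_star W (resolvent (mult_by prd E W) Y) X -
       series_connection nabla W (resolvent (mult_by prd E W) Y) X)"

definition Gauss_Manin_flat ::
  "('a, 'k) sheaf_operation \<Rightarrow> ('a, 'k) sheaf_operation \<Rightarrow> ('a, 'k) sheaf_operation \<Rightarrow>
    ('a, 'k) vector_field \<Rightarrow> 'a set \<Rightarrow> ('a, 'k) series \<Rightarrow> bool"
  where "Gauss_Manin_flat nabla prd nabla_star E V X \<longleftrightarrow>
    (\<forall>W. openin M W \<longrightarrow> W \<subseteq> V \<longrightarrow>
      (\<forall>Y\<in>tangent_sheaf W.
        Gauss_Manin nabla prd nabla_star E W Y (\<lambda>j. restrict_field W (X j)) = 0))"

end

end

theory Submission
  imports Defs
begin

text \<open>
  Write \<open>L = E\<circ>\<close>. Expanding \<open>(L - \<lambda>)\<^sup>-\<^sup>1\<close> in powers of \<open>1/\<lambda>\<close> turns the Gauss--Manin connection into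
  the formula, for the coefficient of \<open>\<lambda>\<^sup>-\<^sup>j\<close>,
  \<open>G\<^sub>j(Y) = \<nabla>*\<^sub>Y X\<^sub>j - (\<Sum>i\<le>j. (\<nabla>* - \<nabla>)\<^bsub>L\<^sup>i Y\<^esub> X\<^bsub>j-i\<^esub>)\<close>.
  The sums for \<open>G\<^bsub>j+1\<^esub>(Y)\<close> and \<open>G\<^sub>j(L Y)\<close> contain the same terms, apart from the term \<open>i = 0\<close> of the
  first one, so the difference telescopes:
  \<open>G\<^bsub>j+1\<^esub>(Y) - G\<^sub>j(L Y) = \<nabla>\<^sub>Y X\<^bsub>j+1\<^esub> - \<nabla>*\<^bsub>L Y\<^esub> X\<^sub>j\<close> (lemma \<open>Gauss_Manin_telescope\<close>).
  A flat section makes the left hand side vanish for all \<open>Y\<close>, which is the Lenard--Magri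
  recurrence.

  The coefficients of the resolvent applied to \<open>Y\<close> are \<open>0\<close> and \<open>-L\<^sup>i Y\<close>, so the formula for \<open>G\<^sub>j\<close>
  rests on \<open>\<nabla>\<^sub>0 = 0\<close> and \<open>\<nabla>\<^bsub>-Z\<^esub> = -\<nabla>\<^sub>Z\<close>. The axioms of a connection only speak of sections of the
  tangent sheaf, so \<open>0\<close> and \<open>-Z\<close> have to be such sections. They are constant multiples of sections, and the
  tangent sheaf is closed under these because both regularity classes of functions are.
\<close>

section \<open>Constant multiples and restrictions of sections\<close>

lemma differentiable_times_scale:
  "differentiable_times m S f \<Longrightarrow> differentiable_times m S (\<lambda>x. c * f x)"
proof (induction m arbitrary: f)
  case 0
  then show ?case by (auto intro: continuous_intros)
next
  case (Suc m)
  then obtain f' where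
    f': "\<And>x. x \<in> S \<Longrightarrow> (f has_derivative (\<lambda>h. \<Sum>i\<in>UNIV. f' i x * h $ i)) (at x)"
    and m: "\<And>i. differentiable_times m S (f' i)"
    by auto
  have "((\<lambda>x. c * f x) has_derivative (\<lambda>h. \<Sum>i\<in>UNIV. (c * f' i x) * h $ i)) (at x)"
    if "x \<in> S" for x
    using has_derivative_mult_right[OF f'[OF that], of c]
    by (simp add: sum_distrib_left mult.assoc)
  with m Suc.IH show ?case
    by (auto intro!: exI[of _ "\<lambda>i x. c * f' i x"])
qed

lemma power_series_on_scale:
  assumes "power_series_on S f"
  shows "power_series_on S (\<lambda>x. c * f x)"
  unfolding power_series_on_def
proof
  fix x assume "x \<in> S"
  then obtain a s where "s > 0"
    and a: "\<forall>y. (\<forall>i. norm (y $ i - x $ i) < s) \<longrightarrow> y \<in> S \<and>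
        ((\<lambda>m. a m * (\<Prod>i\<in>UNIV. (y $ i - x $ i) ^ m i)) has_sum f y) UNIV"
    using bspec[OF assms[unfolded power_series_on_def]] by blast
  have "\<forall>y. (\<forall>i. norm (y $ i - x $ i) < s) \<longrightarrow> y \<in> S \<and>
        ((\<lambda>m. c * a m * (\<Prod>i\<in>UNIV. (y $ i - x $ i) ^ m i)) has_sum c * f y) UNIV"
  proof (intro allI impI)
    fix y assume "\<forall>i. norm (y $ i - x $ i) < s"
    then have y: "y \<in> S"
      and sum: "((\<lambda>m. a m * (\<Prod>i\<in>UNIV. (y $ i - x $ i) ^ m i)) has_sum f y) UNIV"
      using spec[OF a, of y] by (simp_all only: simp_thms)
    show "y \<in> S \<and>
        ((\<lambda>m. c * a m * (\<Prod>i\<in>UNIV. (y $ i - x $ i) ^ m i)) has_sum c * f y) UNIV"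
      using y has_sum_cmult_right[OF sum, of c] by (simp only: mult.assoc)
  qed
  with \<open>s > 0\<close> show "\<exists>a s. s > 0 \<and> (\<forall>y. (\<forall>i. norm (y $ i - x $ i) < s) \<longrightarrow> y \<in> S \<and>
        ((\<lambda>m. a m * (\<Prod>i\<in>UNIV. (y $ i - x $ i) ^ m i)) has_sum c * f y) UNIV)"
    by (intro exI conjI)
qed

lemma regular_on_scale: "regular_on \<rho> S f \<Longrightarrow> regular_on \<rho> S (\<lambda>x. c * f x)"
  by (cases \<rho>) (auto intro: differentiable_times_scale power_series_on_scale)

context manifold
begin

lemma structure_sheaf_scale:
  "f \<in> structure_sheaf W \<Longrightarrow> (\<lambda>p. c * f p) \<in> structure_sheaf W"
  unfolding structure_sheaf_def by (auto intro: regular_on_scale)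

lemma tangent_sheafI:
  assumes "\<And>V f. \<not> (openin M V \<and> V \<subseteq> W \<and> f \<in> structure_sheaf V) \<Longrightarrow> D V f = 0"
    and "\<And>V f. openin M V \<Longrightarrow> V \<subseteq> W \<Longrightarrow> f \<in> structure_sheaf V \<Longrightarrow>
      D V f \<in> structure_sheaf V"
    and "\<And>V f b. openin M V \<Longrightarrow> V \<subseteq> W \<Longrightarrow> f \<in> structure_sheaf V \<Longrightarrow>
      D V (\<lambda>p. b * f p) = (\<lambda>p. b * D V f p)"
    and "\<And>V f g. openin M V \<Longrightarrow> V \<subseteq> W \<Longrightarrow> f \<in> structure_sheaf V \<Longrightarrow> g \<in> structure_sheaf V \<Longrightarrow>
      D V (\<lambda>p. f p + g p) = (\<lambda>p. D V f p + D V g p)"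
    and "\<And>V f g. openin M V \<Longrightarrow> V \<subseteq> W \<Longrightarrow> f \<in> structure_sheaf V \<Longrightarrow> g \<in> structure_sheaf V \<Longrightarrow>
      D V (\<lambda>p. f p * g p) = (\<lambda>p. f p * D V g p + D V f p * g p)"
    and "\<And>V f V'. openin M V \<Longrightarrow> V \<subseteq> W \<Longrightarrow> f \<in> structure_sheaf V \<Longrightarrow>
      openin M V' \<Longrightarrow> V' \<subseteq> V \<Longrightarrow>
      D V' (restrict_function V' f) = restrict_function V' (D V f)"
  shows "D \<in> tangent_sheaf W"
  unfolding tangent_sheaf_def
  by (intro CollectI conjI allI impI ballI) (rule assms; assumption)+

lemma tangent_sheaf_outside:
  assumes "D \<in> tangent_sheaf W" and "\<not> (openin M V \<and> V \<subseteq> W \<and> f \<in> structure_sheaf V)"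
  shows "D V f = 0"
  using conjunct1[OF assms(1)[unfolded tangent_sheaf_def mem_Collect_eq], rule_format, OF assms(2)] .

lemma tangent_sheafD:
  assumes "D \<in> tangent_sheaf W" and "openin M V" and "V \<subseteq> W" and "f \<in> structure_sheaf V"
  shows "D V f \<in> structure_sheaf V"
    and "D V (\<lambda>p. b * f p) = (\<lambda>p. b * D V f p)"
    and "g \<in> structure_sheaf V \<Longrightarrow> D V (\<lambda>p. f p + g p) = (\<lambda>p. D V f p + D V g p)"
    and "g \<in> structure_sheaf V \<Longrightarrow> D V (\<lambda>p. f p * g p) = (\<lambda>p. f p * D V g p + D V f p * g p)"
    and "openin M V' \<Longrightarrow> V' \<subseteq> V \<Longrightarrow>
      D V' (restrict_function V' f) = restrict_function V' (D V f)"
proof -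
  note derivation = conjunct2[OF assms(1)[unfolded tangent_sheaf_def mem_Collect_eq],
      THEN spec, THEN mp, OF assms(2), THEN mp, OF assms(3), THEN bspec, OF assms(4)]
  show "D V f \<in> structure_sheaf V"
    by (rule derivation[THEN conjunct1])
  show "D V (\<lambda>p. b * f p) = (\<lambda>p. b * D V f p)"
    by (rule derivation[THEN conjunct2, THEN conjunct1, THEN spec])
  note sum_prod = derivation[THEN conjunct2, THEN conjunct2, THEN conjunct1, THEN bspec]
  show "D V (\<lambda>p. f p + g p) = (\<lambda>p. D V f p + D V g p)" if "g \<in> structure_sheaf V"
    by (rule sum_prod[OF that, THEN conjunct1])
  show "D V (\<lambda>p. f p * g p) = (\<lambda>p. f p * D V g p + D V f p * g p)" if "g \<in> structure_sheaf V"
    by (rule sum_prod[OF that, THEN conjunct2])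
  show "D V' (restrict_function V' f) = restrict_function V' (D V f)"
    if "openin M V'" "V' \<subseteq> V"
    by (rule derivation[THEN conjunct2, THEN conjunct2, THEN conjunct2, THEN spec, THEN mp,
          THEN mp, OF that])
qed

lemma constant_scale_tangent_sheaf:
  assumes "X \<in> tangent_sheaf W"
  shows "constant_scale c X \<in> tangent_sheaf W"
  unfolding constant_scale_def
proof (rule tangent_sheafI)
  fix V f assume "\<not> (openin M V \<and> V \<subseteq> W \<and> f \<in> structure_sheaf V)"
  then show "(\<lambda>p. c * X V f p) = 0"
    by (simp add: tangent_sheaf_outside[OF assms] fun_eq_iff)
next
  fix V f assume "openin M V" "V \<subseteq> W" "f \<in> structure_sheaf V"
  note X = tangent_sheafD[OF assms this]
  show "(\<lambda>p. c * X V f p) \<in> structure_sheaf V"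
    by (rule structure_sheaf_scale[OF X(1)])
  show "(\<lambda>p. c * X V (\<lambda>p. b * f p) p) = (\<lambda>p. b * (c * X V f p))" for b
    unfolding X(2) by (simp only: mult.left_commute)
  show "(\<lambda>p. c * X V' (restrict_function V' f) p) = restrict_function V' (\<lambda>p. c * X V f p)"
    if "openin M V'" "V' \<subseteq> V" for V'
    unfolding X(5)[OF that] by (simp add: restrict_function_def fun_eq_iff)
  fix g assume g: "g \<in> structure_sheaf V"
  show "(\<lambda>p. c * X V (\<lambda>p. f p + g p) p) = (\<lambda>p. c * X V f p + c * X V g p)"
    unfolding X(3)[OF g] by (simp only: distrib_left)
  show "(\<lambda>p. c * X V (\<lambda>p. f p * g p) p) = (\<lambda>p. f p * (c * X V g p) + c * X V f p * g p)"
    unfolding X(4)[OF g] by (simp add: fun_eq_iff algebra_simps)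
qed

lemma uminus_tangent_sheaf:
  assumes "X \<in> tangent_sheaf W"
  shows "- X \<in> tangent_sheaf W"
proof -
  have "- X = constant_scale (- 1) X"
    by (simp add: constant_scale_def fun_eq_iff)
  with constant_scale_tangent_sheaf[OF assms] show ?thesis by simp
qed

lemma zero_tangent_sheaf:
  assumes "X \<in> tangent_sheaf W"
  shows "0 \<in> tangent_sheaf W"
proof -
  have "0 = constant_scale 0 X"
    by (simp add: constant_scale_def fun_eq_iff)
  with constant_scale_tangent_sheaf[OF assms] show ?thesis by metis
qed

lemma restrict_field_tangent_sheaf:
  assumes "X \<in> tangent_sheaf V" and "W \<subseteq> V"
  shows "restrict_field W X \<in> tangent_sheaf W"
proof (rule tangent_sheafI)
  fix V' f assume "\<not> (openin M V' \<and> V' \<subseteq> W \<and> f \<in> structure_sheaf V')"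
  then show "restrict_field W X V' f = 0"
    using tangent_sheaf_outside[OF assms(1), of V' f] by (auto simp: restrict_field_def)
next
  have agree: "restrict_field W X V' = X V'" if "V' \<subseteq> W" for V'
    using that by (simp add: restrict_field_def)
  fix V' f assume V': "openin M V'" "V' \<subseteq> W" and f: "f \<in> structure_sheaf V'"
  note X = tangent_sheafD[OF assms(1) V'(1) subset_trans[OF V'(2) assms(2)] f]
  show "restrict_field W X V' f \<in> structure_sheaf V'"
    unfolding agree[OF V'(2)] by (rule X(1))
  show "restrict_field W X V' (\<lambda>p. b * f p) = (\<lambda>p. b * restrict_field W X V' f p)" for b
    unfolding agree[OF V'(2)] by (rule X(2))
  show "restrict_field W X V'' (restrict_function V'' f) =
      restrict_function V'' (restrict_field W X V' f)"
    if "openin M V''" "V'' \<subseteq> V'" for V''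
    unfolding agree[OF V'(2)] agree[OF subset_trans[OF that(2) V'(2)]] by (rule X(5)[OF that])
  fix g assume g: "g \<in> structure_sheaf V'"
  show "restrict_field W X V' (\<lambda>p. f p + g p) =
      (\<lambda>p. restrict_field W X V' f p + restrict_field W X V' g p)"
    unfolding agree[OF V'(2)] by (rule X(3)[OF g])
  show "restrict_field W X V' (\<lambda>p. f p * g p) =
      (\<lambda>p. f p * restrict_field W X V' g p + restrict_field W X V' f p * g p)"
    unfolding agree[OF V'(2)] by (rule X(4)[OF g])
qed

section \<open>The Gauss--Manin connection coefficient by coefficient\<close>

lemma connection_direction_add:
  assumes "connection U nabla" and "openin M W" and "W \<subseteq> U"
    and "Y \<in> tangent_sheaf W" and "Z \<in> tangent_sheaf W" and "X \<in> tangent_sheaf W"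
  shows "nabla W (Y + Z) X = nabla W Y X + nabla W Z X"
  using conjunct2[OF assms(1)[unfolded connection_def], THEN spec, THEN mp, OF assms(2), THEN mp,
      OF assms(3), THEN bspec, OF assms(4), THEN bspec, OF assms(6), THEN conjunct1, THEN bspec,
      OF assms(5), THEN conjunct1] .

lemma connection_direction_zero:
  assumes "connection U nabla" and "openin M W" and "W \<subseteq> U" and "X \<in> tangent_sheaf W"
  shows "nabla W 0 X = 0"
proof -
  have "nabla W (0 + 0) X = nabla W 0 X + nabla W 0 X"
    using connection_direction_add[OF assms(1-3)] zero_tangent_sheaf[OF assms(4)] assms(4)
    by blast
  then show ?thesis by simp
qed

lemma connection_direction_uminus:
  assumes "connection U nabla" and "openin M W" and "W \<subseteq> U"
    and "Y \<in> tangent_sheaf W" and "X \<in> tangent_sheaf W"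
  shows "nabla W (- Y) X = - nabla W Y X"
proof -
  have "nabla W (Y + (- Y)) X = nabla W Y X + nabla W (- Y) X"
    using connection_direction_add[OF assms(1-3)] uminus_tangent_sheaf[OF assms(4)] assms(4,5)
    by blast
  then show ?thesis
    using connection_direction_zero[OF assms(1-3,5)] by (simp add: minus_unique)
qed

text \<open>
  The shift from \<open>Suc j\<close> to \<open>j\<close> arises because the resolvent has no constant term: its expansion
  starts at \<open>\<lambda>\<^sup>-\<^sup>1\<close>. The factor \<open>\<lambda>\<close> in the Gauss--Manin connection undoes this shift.
\<close>

lemma series_connection_resolvent:
  assumes "connection U nabla" and "openin M W" and "W \<subseteq> U"
    and "\<And>i. (L ^^ i) Y \<in> tangent_sheaf W" and "\<And>i. X i \<in> tangent_sheaf W"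
  shows "series_connection nabla W (resolvent L Y) X (Suc j) =
    - (\<Sum>i\<le>j. nabla W ((L ^^ i) Y) (X (j - i)))"
  unfolding series_connection_def sum.atMost_Suc_shift
  using connection_direction_zero[OF assms(1-3)] connection_direction_uminus[OF assms(1-3)]
    assms(4,5)
  by (simp add: resolvent_def sum_negf)

lemma Gauss_Manin_coefficient:
  assumes "connection U nabla" and "connection U' nabla_star"
    and "openin M W" and "W \<subseteq> U" and "W \<subseteq> U'"
    and "\<And>i. (mult_by prd E W ^^ i) Y \<in> tangent_sheaf W"
    and "\<And>i. X i \<in> tangent_sheaf W"
  shows "Gauss_Manin nabla prd nabla_star E W Y X j = nabla_star W Y (X j) -
    (\<Sum>i\<le>j. nabla_star W ((mult_by prd E W ^^ i) Y) (X (j - i)) -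
           nabla W ((mult_by prd E W ^^ i) Y) (X (j - i)))"
  using series_connection_resolvent[OF assms(1,3,4,6,7)]
    series_connection_resolvent[OF assms(2,3,5,6,7)]
  by (simp add: Gauss_Manin_def lambda_times_def sum_subtractf fun_eq_iff)

text \<open>
  Since \<open>L\<^sup>i (L Y) = L\<^bsup>i+1\<^esup> Y\<close>, the sum in the coefficient \<open>j\<close> in the direction \<open>L Y\<close> is the sum in
  the coefficient \<open>j + 1\<close> in the direction \<open>Y\<close> without its first term
  \<open>\<nabla>*\<^sub>Y X\<^bsub>j+1\<^esub> - \<nabla>\<^sub>Y X\<^bsub>j+1\<^esub>\<close>, whose \<open>\<nabla>*\<close>-part cancels the leading term of that coefficient.
\<close>

lemma Gauss_Manin_telescope:
  assumes "connection U nabla" and "connection U' nabla_star"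
    and "openin M W" and "W \<subseteq> U" and "W \<subseteq> U'"
    and L: "\<And>Z. Z \<in> tangent_sheaf W \<Longrightarrow> mult_by prd E W Z \<in> tangent_sheaf W"
    and Y: "Y \<in> tangent_sheaf W"
    and X: "\<And>i. X i \<in> tangent_sheaf W"
  shows "Gauss_Manin nabla prd nabla_star E W Y X (Suc j) -
      Gauss_Manin nabla prd nabla_star E W (mult_by prd E W Y) X j =
    nabla W Y (X (Suc j)) - nabla_star W (mult_by prd E W Y) (X j)"
proof -
  have pow: "(mult_by prd E W ^^ i) Z \<in> tangent_sheaf W" if "Z \<in> tangent_sheaf W" for i Z
    by (induction i) (simp_all add: that L)
  note coefficient = Gauss_Manin_coefficient[OF assms(1-5) pow X]
  show ?thesis
    unfolding coefficient[OF Y] coefficient[OF L[OF Y]] sum.atMost_Suc_shift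
    by (simp add: funpow_swap1)
qed

end

section \<open>The Lenard--Magri recurrence\<close>

theorem theorem4p5:
  fixes r :: regularity
    and M :: "'a topology"
    and A :: "('a set \<times> ('a \<Rightarrow> 'k::real_normed_field ^ 'n::finite)) set"
    and nabla prd nabla_star prd_star :: "('a, 'k) sheaf_operation"
    and e E :: "('a, 'k) vector_field"
    and V :: "'a set"
    and X :: "('a, 'k) series"
  assumes "manifold r M A"
    and "manifold.bi_flat_F_manifold r M A nabla prd e nabla_star prd_star E"
    and "openin M V" and "V \<subseteq> manifold.invertible_locus r M A prd E"
    and "\<And>\<alpha>. X \<alpha> \<in> manifold.tangent_sheaf r M A V"
    and "manifold.Gauss_Manin_flat r M A nabla prd nabla_star E V X"
  shows "(\<forall>\<alpha>. manifold.d_nabla r M A nabla V (X (Suc \<alpha>)) =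
               manifold.d_L_nabla r M A nabla_star prd E V (X \<alpha>)) \<and>
         (\<forall>\<alpha> W. openin M W \<longrightarrow> W \<subseteq> V \<longrightarrow>
           (\<forall>Y\<in>manifold.tangent_sheaf r M A W.
             nabla W Y (restrict_field W (X (Suc \<alpha>))) =
             nabla_star W (prd W (restrict_field W E) Y) (restrict_field W (X \<alpha>))))"
proof -
  interpret manifold r M A by fact
  define U where "U = invertible_locus prd E"
  have bilinear: "bilinear_operation (topspace M) prd"
    and E: "E \<in> tangent_sheaf (topspace M)"
    and nabla: "connection (topspace M) nabla"
    and nabla_star: "connection U nabla_star"
    using assms(2)
    unfolding bi_flat_F_manifold_def Let_def flat_F_manifold_def F_manifold_def
      Euler_field_def U_def
    by blast+
  have recurrence: "nabla W Y (restrict_field W (X (Suc \<alpha>))) =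
      nabla_star W (mult_by prd E W Y) (restrict_field W (X \<alpha>))"
    if W: "openin M W" "W \<subseteq> V" and Y: "Y \<in> tangent_sheaf W" for \<alpha> W Y
  proof -
    have WM: "W \<subseteq> topspace M" and WU: "W \<subseteq> U"
      using W assms(4) openin_subset[OF W(1)] U_def by auto
    have L: "mult_by prd E W Z \<in> tangent_sheaf W" if "Z \<in> tangent_sheaf W" for Z
      using bilinear W(1) WM that restrict_field_tangent_sheaf[OF E WM]
      unfolding bilinear_operation_def sheaf_morphism_def mult_by_def by blast
    have zero: "Gauss_Manin nabla prd nabla_star E W Z (\<lambda>j. restrict_field W (X j)) = 0"
      if "Z \<in> tangent_sheaf W" for Z
      using assms(6) W that unfolding Gauss_Manin_flat_def by blast
    show ?thesis
      using Gauss_Manin_telescope[where X = "\<lambda>j. restrict_field W (X j)" and j = \<alpha>,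
          OF nabla nabla_star W(1) WM WU L Y restrict_field_tangent_sheaf[OF assms(5) W(2)]]
      by (simp add: zero[OF Y] zero[OF L[OF Y]])
  qed
  show ?thesis
    using recurrence by (auto simp: d_nabla_def d_L_nabla_def mult_by_def fun_eq_iff)
qed

end
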